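(* Let $L$ be a locally compact topological loop and let $\mu$ be a left quasi-invariant Radon measure on $L$ with left modular cocycle $\lambda(a,x)=\frac{d(L_a)_*\mu}{d\mu}(x)$. For $a,b\in L$ let $\Phi_{a,b}=L_a\circ L_b\circ L_{ab}^{-1}$ be the associativity deviation homeomorphism and $J_\Phi(a,b;x)=\frac{d(\Phi_{a,b})_*\mu}{d\mu}(x)$ its Radon--Nikodym derivative. If $L$ is associative, then $\Phi_{a,b}=\mathrm{id}_L$ and $J_\Phi(a,b;x)=1$. Hence $$\lambda(a,x)\,\lambda\bigl(b,L_a^{-1}x\bigr)=\lambda(ab,x)$$ for all $a,b\in L$ and $\mu$-almost every $x\in L$. In particular, if $\lambda(a,x)=\Delta_L(a)$ is independent of $x$, then $$\Delta_L(ab)=\Delta_L(a)\,\Delta_L(b),$$ so the classical modular function is recovered.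
   Context: A loop is a set $L$ with a binary operation $(x,y)\mapsto xy$ and an element $e\in L$ with $ex=xe=x$ for all $x\in L$, such that for all $a,b\in L$ the equations $ax=b$ and $ya=b$ have unique solutions. A topological loop is a loop with a Hausdorff topology for which multiplication and the left and right division operations are continuous. For $a\in L$ the left translation is $L_a:L\to L$, $L_a(x)=ax$; it is a homeomorphism of $L$, with inverse map $L_a^{-1}$. For a homeomorphism $f:L\to L$, $f_*\mu$ denotes the pushforward measure $f_*\mu(E)=\mu(f^{-1}(E))$. The measure $\mu$ is left quasi-invariant if $(L_a)_*\mu\ll\mu$ for every $a\in L$; the source states this as equivalent to the existence, for each $a\in L$, of a positive measurable function $\lambda(a,\cdot):L\to\mathbb{R}_{>0}$ with $\frac{d(L_a)_*\mu}{d\mu}(x)=\lambda(a,x)$ for $\mu$-almost every $x\in L$. The function $\lambda$ is the left modular cocycle of $\mu$. If the derivative is independent of $x$, its common value is denoted $\Delta_L(a)$. "The classical modular function" refers to the modular function of a locally compact group.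
   Formalization: Identification of Δ_L with the classical modular function is stated only for μ a right Haar measure (it fails e.g. for e^x dx on the real line), and the Δ_L part assumes μ nonzero. *)

theory Defs
  imports "HOL-Analysis.Analysis"
begin

locale loop =
  fixes mul :: "'a \<Rightarrow> 'a \<Rightarrow> 'a" (infixl "\<cdot>" 70)
    and e :: 'a
  assumes left_unit: "e \<cdot> x = x"
    and right_unit: "x \<cdot> e = x"
    and left_solvable: "\<exists>!x. a \<cdot> x = b"
    and right_solvable: "\<exists>!y. y \<cdot> a = b"

definition left_div :: "('a \<Rightarrow> 'a \<Rightarrow> 'a) \<Rightarrow> 'a \<Rightarrow> 'a \<Rightarrow> 'a" where
  "left_div mul a b = (THE x. mul a x = b)"

definition right_div :: "('a \<Rightarrow> 'a \<Rightarrow> 'a) \<Rightarrow> 'a \<Rightarrow> 'a \<Rightarrow> 'a" where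
  "right_div mul b a = (THE y. mul y a = b)"

locale topological_loop = loop mul e
  for mul :: "'a::t2_space \<Rightarrow> 'a \<Rightarrow> 'a" (infixl "\<cdot>" 70) and e :: 'a +
  assumes continuous_mul: "continuous_on UNIV (\<lambda>(x, y). x \<cdot> y)"
    and continuous_left_div: "continuous_on UNIV (\<lambda>(a, b). left_div mul a b)"
    and continuous_right_div: "continuous_on UNIV (\<lambda>(b, a). right_div mul b a)"

text \<open>
  Radon measures: locally finite Borel measures that are inner regular with respect to
  compact sets on all Borel sets. No sigma-finiteness is assumed. Requiring inner regularity
  on all Borel sets, rather than on open sets only, makes the measure semifinite, and hence
  makes densities unique almost everywhere.
\<close>

definition radon_measure :: "'a::t2_space measure \<Rightarrow> bool" where
  "radon_measure \<mu> \<longleftrightarrow>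
     sets \<mu> = sets borel \<and>
     (\<forall>x. \<exists>U. open U \<and> x \<in> U \<and> emeasure \<mu> U < \<infinity>) \<and>
     (\<forall>B\<in>sets borel. emeasure \<mu> B = (SUP K\<in>{K. compact K \<and> K \<subseteq> B}. emeasure \<mu> K))"

text \<open>The left translation by \<open>a\<close> is the partial application \<open>mul a\<close>.\<close>

definition left_quasi_invariant ::
    "('a::t2_space \<Rightarrow> 'a \<Rightarrow> 'a) \<Rightarrow> 'a measure \<Rightarrow> bool" where
  "left_quasi_invariant mul \<mu> \<longleftrightarrow> (\<forall>a. absolutely_continuous \<mu> (distr \<mu> \<mu> (mul a)))"

text \<open>
  \<open>RN_deriv\<close> is zero when no density exists, so positivity of \<open>l\<close> forces the
  density of the translated measure to exist.
\<close>

definition left_modular_cocycle ::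
    "('a::t2_space \<Rightarrow> 'a \<Rightarrow> 'a) \<Rightarrow> 'a measure \<Rightarrow> ('a \<Rightarrow> 'a \<Rightarrow> real) \<Rightarrow> bool" where
  "left_modular_cocycle mul \<mu> l \<longleftrightarrow>
     (\<forall>a. l a \<in> borel_measurable borel \<and> (\<forall>x. 0 < l a x) \<and>
          (AE x in \<mu>. RN_deriv \<mu> (distr \<mu> \<mu> (mul a)) x = ennreal (l a x)))"

definition assoc_deviation :: "('a \<Rightarrow> 'a \<Rightarrow> 'a) \<Rightarrow> 'a \<Rightarrow> 'a \<Rightarrow> 'a \<Rightarrow> 'a" where
  "assoc_deviation mul a b = mul a \<circ> mul b \<circ> inv (mul (mul a b))"

definition assoc_jacobian ::
    "('a::t2_space \<Rightarrow> 'a \<Rightarrow> 'a) \<Rightarrow> 'a measure \<Rightarrow> 'a \<Rightarrow> 'a \<Rightarrow> 'a \<Rightarrow> ennreal" where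
  "assoc_jacobian mul \<mu> a b = RN_deriv \<mu> (distr \<mu> \<mu> (assoc_deviation mul a b))"

definition left_haar_measure :: "('a::t2_space \<Rightarrow> 'a \<Rightarrow> 'a) \<Rightarrow> 'a measure \<Rightarrow> bool" where
  "left_haar_measure mul \<nu> \<longleftrightarrow>
     radon_measure \<nu> \<and> emeasure \<nu> UNIV \<noteq> 0 \<and> (\<forall>a. distr \<nu> \<nu> (mul a) = \<nu>)"

definition right_haar_measure :: "('a::t2_space \<Rightarrow> 'a \<Rightarrow> 'a) \<Rightarrow> 'a measure \<Rightarrow> bool" where
  "right_haar_measure mul \<nu> \<longleftrightarrow>
     radon_measure \<nu> \<and> emeasure \<nu> UNIV \<noteq> 0 \<and> (\<forall>a. distr \<nu> \<nu> (\<lambda>x. mul x a) = \<nu>)"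

text \<open>
  The modular function of a locally compact group, in the convention
  \<open>\<nu>(E a) = \<Delta>(a) \<nu>(E)\<close> for a left Haar measure \<open>\<nu>\<close>. As Haar measure is unique up to a
  positive factor, \<open>\<Delta>\<close> does not depend on which \<open>\<nu>\<close> is taken, and at most one \<open>\<Delta>\<close>
  satisfies this predicate.
\<close>

definition is_modular_function ::
    "('a::t2_space \<Rightarrow> 'a \<Rightarrow> 'a) \<Rightarrow> ('a \<Rightarrow> real) \<Rightarrow> bool" where
  "is_modular_function mul \<Delta> \<longleftrightarrow>
     (\<exists>\<nu>. left_haar_measure mul \<nu> \<and>
        (\<forall>a. 0 < \<Delta> a \<and>
          (\<forall>E\<in>sets borel. emeasure \<nu> ((\<lambda>x. mul x a) ` E) = ennreal (\<Delta> a) * emeasure \<nu> E)))"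

end

theory Submission
  imports Defs
begin

text \<open>
  An associative loop is a group, so \<open>L\<^sub>a \<circ> L\<^sub>b = L\<^bsub>ab\<^esub>\<close>, and the deviation is the identity. Pushing
  \<open>\<mu>\<close> forward first along \<open>L\<^sub>b\<close> and then along \<open>L\<^sub>a\<close> multiplies densities according to the chain
  rule and shows that \<open>\<lambda>(a,x) \<lambda>(b, L\<^sub>a\<inverse>x)\<close> is a density of the translate of \<open>\<mu>\<close> by \<open>ab\<close>. The
  function \<open>\<lambda>(ab,x)\<close> is another one, so everything rests on the almost everywhere uniqueness of
  densities (\<open>radon_density_unique\<close>).

  As \<open>\<mu>\<close> may fail to be \<open>\<sigma>\<close>-finite, this uniqueness is not the usual one. It comes from
  inner regularity instead: a set of positive measure on which two densities differ contains a
  compact set of positive measure, which has finite measure because \<open>\<mu>\<close> is locally finite, and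
  there the two integrals can be compared.

  If \<open>\<lambda>(a,x) = \<Delta>(a)\<close> does not depend on \<open>x\<close>, translation by \<open>a\<close> scales \<open>\<mu>\<close> by \<open>\<Delta>(a)\<close>, that is,
  \<open>\<mu>(a\<inverse>E) = \<Delta>(a) \<mu>(E)\<close>. When \<open>\<mu>\<close> is moreover a right Haar measure, its image \<open>\<nu>(E) = \<mu>(E\<inverse>)\<close>
  under inversion is a left Haar measure, and
  \<open>\<nu>(Ea) = \<mu>(a\<inverse>E\<inverse>) = \<Delta>(a) \<nu>(E)\<close>
  identifies \<open>\<Delta>\<close> as the modular function.
\<close>

section \<open>Radon measures\<close>

lemma radon_measure_sets: "radon_measure \<mu> \<Longrightarrow> sets \<mu> = sets borel"
  by (simp add: radon_measure_def)

lemma radon_measure_space: "radon_measure \<mu> \<Longrightarrow> space \<mu> = UNIV"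
  by (metis radon_measure_sets sets_eq_imp_space_eq space_borel)

lemma continuous_measurable_radon:
  assumes "radon_measure \<mu>" and "continuous_on UNIV f"
  shows "f \<in> measurable \<mu> \<mu>"
  using borel_measurable_continuous_onI[OF assms(2)]
    measurable_cong_sets[OF radon_measure_sets[OF assms(1)] radon_measure_sets[OF assms(1)]]
  by simp

lemma borel_measurable_radon:
  "radon_measure \<mu> \<Longrightarrow> f \<in> borel_measurable borel \<Longrightarrow> f \<in> borel_measurable \<mu>"
  using measurable_cong_sets[OF radon_measure_sets refl] by blast

lemma radon_measure_compact_finite:
  assumes \<mu>: "radon_measure \<mu>" and K: "compact K"
  shows "emeasure \<mu> K < \<infinity>"
proof -
  have "\<exists>U. open U \<and> x \<in> U \<and> emeasure \<mu> U < \<infinity>" for x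
    using \<mu> by (simp add: radon_measure_def)
  then obtain U where U: "\<And>x. open (U x)" "\<And>x. x \<in> U x" "\<And>x. emeasure \<mu> (U x) < \<infinity>"
    by metis
  have "K \<subseteq> (\<Union>x\<in>K. U x)"
    using U(2) by blast
  then obtain D where D: "D \<subseteq> K" "finite D" "K \<subseteq> (\<Union>x\<in>D. U x)"
    using compactE_image[OF K, of K U] U(1) by metis
  have sets: "U x \<in> sets \<mu>" for x
    using U(1) radon_measure_sets[OF \<mu>] by simp
  have "emeasure \<mu> K \<le> emeasure \<mu> (\<Union>x\<in>D. U x)"
    using D sets by (intro emeasure_mono) auto
  also have "\<dots> \<le> (\<Sum>x\<in>D. emeasure \<mu> (U x))"
    using D(2) sets by (intro emeasure_subadditive_finite) auto
  also have "\<dots> < \<infinity>"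
    using D(2) U(3) by (simp add: less_top[symmetric])
  finally show ?thesis .
qed

text \<open>
  One half of uniqueness. On a set where \<open>f < g\<close>, the function \<open>f\<close> is finite, so up to a countable
  union it may be taken to be bounded; on a compact subset of positive measure the integral of \<open>f\<close>
  is then finite and strictly smaller than that of \<open>g\<close>.
\<close>

lemma radon_density_le:
  fixes f g :: "'a::t2_space \<Rightarrow> ennreal"
  assumes \<mu>: "radon_measure \<mu>"
    and f[measurable]: "f \<in> borel_measurable \<mu>" and g[measurable]: "g \<in> borel_measurable \<mu>"
    and eq: "density \<mu> f = density \<mu> g"
  shows "AE x in \<mu>. g x \<le> f x"
proof -
  let ?A = "\<lambda>n::nat. {x \<in> space \<mu>. f x < g x \<and> f x \<le> of_nat n}"
  have "?A n \<in> null_sets \<mu>" for n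
  proof (rule ccontr)
    assume "?A n \<notin> null_sets \<mu>"
    moreover have A: "?A n \<in> sets \<mu>" by measurable
    ultimately have "0 < emeasure \<mu> (?A n)"
      by (auto simp: null_sets_def zero_less_iff_neq_zero)
    also have "emeasure \<mu> (?A n) = (SUP K\<in>{K. compact K \<and> K \<subseteq> ?A n}. emeasure \<mu> K)"
      using \<mu> A by (auto simp: radon_measure_def)
    finally obtain K where K: "compact K" "K \<subseteq> ?A n" "0 < emeasure \<mu> K"
      by (auto simp: less_SUP_iff)
    have Ks[measurable]: "K \<in> sets \<mu>"
      using K(1) radon_measure_sets[OF \<mu>] by (simp add: borel_compact)
    have "(\<integral>\<^sup>+x. f x * indicator K x \<partial>\<mu>) \<le> (\<integral>\<^sup>+x. of_nat n * indicator K x \<partial>\<mu>)"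
      using K(2) by (intro nn_integral_mono) (auto split: split_indicator)
    also have "\<dots> = of_nat n * emeasure \<mu> K"
      by (simp add: nn_integral_cmult_indicator)
    also have "\<dots> < \<infinity>"
      using radon_measure_compact_finite[OF \<mu> K(1)] by (simp add: ennreal_mult_less_top of_nat_less_top)
    finally have fin: "(\<integral>\<^sup>+x. f x * indicator K x \<partial>\<mu>) \<noteq> \<infinity>" by simp
    have "\<not> (AE x in \<mu>. g x * indicator K x \<le> f x * indicator K x)"
    proof
      assume "AE x in \<mu>. g x * indicator K x \<le> f x * indicator K x"
      then have "AE x in \<mu>. x \<notin> K"
        using K(2) by (auto elim!: eventually_mono simp: not_le[symmetric])
      then show False
        using K(3) Ks by (simp add: AE_iff_null_sets[symmetric] null_sets_def)
    qed
    moreover have "AE x in \<mu>. f x * indicator K x \<le> g x * indicator K x"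
      using K(2) by (intro AE_I2) (auto split: split_indicator)
    ultimately have "(\<integral>\<^sup>+x. f x * indicator K x \<partial>\<mu>) < (\<integral>\<^sup>+x. g x * indicator K x \<partial>\<mu>)"
      using fin by (intro nn_integral_less) auto
    moreover have "emeasure (density \<mu> f) K = emeasure (density \<mu> g) K"
      using eq by simp
    ultimately show False
      by (simp add: emeasure_density)
  qed
  then have "(\<Union>n. ?A n) \<in> null_sets \<mu>"
    by blast
  then have "AE x in \<mu>. x \<notin> (\<Union>n. ?A n)"
    by (rule AE_not_in)
  then show ?thesis
  proof (rule AE_mp, intro AE_I2 impI)
    fix x assume x: "x \<in> space \<mu>" "x \<notin> (\<Union>n. ?A n)"
    show "g x \<le> f x"
    proof (rule ccontr)
      assume "\<not> g x \<le> f x"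
      then have *: "f x < g x" by simp
      then have "f x < top" using less_le_trans top_greatest by blast
      then obtain n :: nat where "f x < of_nat n"
        using ennreal_Ex_less_of_nat by blast
      with * x show False by (auto intro: less_imp_le)
    qed
  qed
qed

lemma radon_density_unique:
  fixes f g :: "'a::t2_space \<Rightarrow> ennreal"
  assumes "radon_measure \<mu>" "f \<in> borel_measurable \<mu>" "g \<in> borel_measurable \<mu>"
    and "density \<mu> f = density \<mu> g"
  shows "AE x in \<mu>. f x = g x"
  using radon_density_le[OF assms] radon_density_le[OF assms(1,3,2) assms(4)[symmetric]]
  by eventually_elim simp

lemma radon_measure_distr_homeomorphism:
  assumes \<mu>: "radon_measure \<mu>"
    and f: "continuous_on UNIV f" and g: "continuous_on UNIV g"
    and fg: "\<And>x. f (g x) = x" and gf: "\<And>x. g (f x) = x"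
  shows "radon_measure (distr \<mu> \<mu> f)"
proof -
  have fm: "f \<in> measurable \<mu> \<mu>"
    by (rule continuous_measurable_radon[OF \<mu> f])
  have em: "emeasure (distr \<mu> \<mu> f) B = emeasure \<mu> (f -` B)" if "B \<in> sets borel" for B
    using that radon_measure_sets[OF \<mu>] radon_measure_space[OF \<mu>] fm by (simp add: emeasure_distr)
  show ?thesis
    unfolding radon_measure_def
  proof (intro conjI allI ballI)
    show "sets (distr \<mu> \<mu> f) = sets borel"
      using radon_measure_sets[OF \<mu>] by simp
  next
    fix x
    obtain U where U: "open U" "g x \<in> U" "emeasure \<mu> U < \<infinity>"
      using \<mu> unfolding radon_measure_def by blast
    have "open (g -` U)"
      using U(1) g by (rule open_vimage)
    moreover have "f -` (g -` U) = U"
      by (auto simp: gf)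
    ultimately have "emeasure (distr \<mu> \<mu> f) (g -` U) < \<infinity>"
      using em[of "g -` U"] U(3) by simp
    with \<open>open (g -` U)\<close> U(2) show "\<exists>V. open V \<and> x \<in> V \<and> emeasure (distr \<mu> \<mu> f) V < \<infinity>"
      by blast
  next
    fix B :: "'a set" assume B: "B \<in> sets borel"
    let ?S = "SUP K\<in>{K. compact K \<and> K \<subseteq> B}. emeasure (distr \<mu> \<mu> f) K"
    have "f -` B \<in> sets borel"
      using measurable_sets[OF fm] B radon_measure_sets[OF \<mu>] radon_measure_space[OF \<mu>] by simp
    then have "emeasure \<mu> (f -` B) = (SUP K\<in>{K. compact K \<and> K \<subseteq> f -` B}. emeasure \<mu> K)"
      using \<mu> by (simp add: radon_measure_def)
    also have "\<dots> \<le> ?S"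
    proof (rule SUP_least)
      fix K assume K: "K \<in> {K. compact K \<and> K \<subseteq> f -` B}"
      have "compact (f ` K)"
        using K by (intro compact_continuous_image continuous_on_subset[OF f]) auto
      moreover have "f -` (f ` K) = K"
        by (auto simp: image_iff) (metis gf)
      ultimately have "emeasure \<mu> K = emeasure (distr \<mu> \<mu> f) (f ` K)"
        by (simp add: em borel_compact)
      also have "\<dots> \<le> ?S"
        using K \<open>compact (f ` K)\<close> by (intro SUP_upper) auto
      finally show "emeasure \<mu> K \<le> ?S" .
    qed
    finally have "emeasure (distr \<mu> \<mu> f) B \<le> ?S"
      using em[OF B] by simp
    moreover have "?S \<le> emeasure (distr \<mu> \<mu> f) B"
      using B radon_measure_sets[OF \<mu>] by (intro SUP_least emeasure_mono) auto
    ultimately show "emeasure (distr \<mu> \<mu> f) B = ?S"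
      by (rule antisym)
  qed
qed

section \<open>Translations of a topological loop\<close>

context topological_loop
begin

lemma mul_left_div: "a \<cdot> left_div mul a b = b"
  unfolding left_div_def by (rule theI') (rule left_solvable)

lemma left_div_mul: "left_div mul a (a \<cdot> x) = x"
  using left_solvable[of a "a \<cdot> x"] mul_left_div by blast

lemma inv_left_translation: "inv (mul a) = left_div mul a"
  by (rule inv_equality) (simp_all add: mul_left_div left_div_mul)

lemma continuous_left_translation: "continuous_on UNIV (mul a)"
  using continuous_on_compose2[OF continuous_mul, of UNIV "\<lambda>x. (a, x)"]
  by (simp add: continuous_on_Pair)

lemma continuous_right_translation: "continuous_on UNIV (\<lambda>x. x \<cdot> a)"
  using continuous_on_compose2[OF continuous_mul, of UNIV "\<lambda>x. (x, a)"]
  by (simp add: continuous_on_Pair)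

lemma continuous_inv_left_translation: "continuous_on UNIV (inv (mul a))"
  using continuous_on_compose2[OF continuous_left_div, of UNIV "\<lambda>x. (a, x)"]
  by (simp add: continuous_on_Pair inv_left_translation)

end

text \<open>
  \<open>RN_deriv\<close> is zero if no density exists, so a positive cocycle exhibits one, except
  on the zero measure, where every function is a density.
\<close>

lemma left_modular_cocycle_density:
  assumes \<mu>: "radon_measure \<mu>" and l: "left_modular_cocycle mul \<mu> l"
    and cont: "continuous_on UNIV (mul a)"
  shows "distr \<mu> \<mu> (mul a) = density \<mu> (\<lambda>x. ennreal (l a x))"
proof -
  let ?N = "distr \<mu> \<mu> (mul a)"
  have l_meas: "l a \<in> borel_measurable borel" and l_pos: "\<And>x. 0 < l a x"
    and RN: "AE x in \<mu>. RN_deriv \<mu> ?N x = ennreal (l a x)"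
    using l unfolding left_modular_cocycle_def by blast+
  have [measurable]: "(\<lambda>x. ennreal (l a x)) \<in> borel_measurable \<mu>"
    using borel_measurable_radon[OF \<mu> l_meas] by simp
  have m: "mul a \<in> measurable \<mu> \<mu>"
    by (rule continuous_measurable_radon[OF \<mu> cont])
  show ?thesis
  proof (cases "\<exists>f\<in>borel_measurable \<mu>. density \<mu> f = ?N")
    case True
    then have "density \<mu> (RN_deriv \<mu> ?N) = ?N"
      using RN_derivI by blast
    moreover have "density \<mu> (RN_deriv \<mu> ?N) = density \<mu> (\<lambda>x. ennreal (l a x))"
      using RN by (intro density_cong) auto
    ultimately show ?thesis by simp
  next
    case False
    then have "RN_deriv \<mu> ?N = (\<lambda>_. 0)"
      unfolding RN_deriv_def by auto
    with RN have AE_False: "AE x in \<mu>. False"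
      by (auto elim!: eventually_mono simp: ennreal_eq_0_iff not_le[THEN iffD2, OF l_pos])
    have null: "emeasure \<mu> A = 0" if "A \<in> sets \<mu>" for A
    proof -
      have "AE x in \<mu>. x \<notin> A"
        using AE_False by eventually_elim simp
      then show ?thesis
        using AE_iff_null_sets[OF that] by (simp add: null_setsD1)
    qed
    show ?thesis
    proof (rule measure_eqI)
      fix A assume "A \<in> sets ?N"
      then have A: "A \<in> sets \<mu>" by simp
      have "(\<integral>\<^sup>+x. ennreal (l a x) * indicator A x \<partial>\<mu>) = (\<integral>\<^sup>+x. 0 \<partial>\<mu>)"
        using AE_False by (intro nn_integral_cong_AE) (auto elim: eventually_mono)
      then show "emeasure ?N A = emeasure (density \<mu> (\<lambda>x. ennreal (l a x))) A"
        using A m measurable_sets[OF m A] by (simp add: emeasure_distr emeasure_density null)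
    qed simp
  qed
qed

section \<open>Associative loops\<close>

locale associative_topological_loop = topological_loop +
  assumes assoc: "(a \<cdot> b) \<cdot> c = a \<cdot> (b \<cdot> c)"
begin

lemma assoc_deviation_id: "assoc_deviation mul a b = id"
proof
  fix x
  have "a \<cdot> (b \<cdot> left_div mul (a \<cdot> b) x) = (a \<cdot> b) \<cdot> left_div mul (a \<cdot> b) x"
    by (simp only: assoc)
  then show "assoc_deviation mul a b x = id x"
    by (simp add: assoc_deviation_def inv_left_translation mul_left_div)
qed

text \<open>
  The chain rule for densities: moving \<open>L\<^sub>a\<close> inside the density of the translate by \<open>b\<close> evaluates
  that density at \<open>L\<^sub>a\<inverse>x\<close>.
\<close>

lemma density_translate_mul:
  assumes \<mu>: "radon_measure \<mu>"
    and p: "p \<in> borel_measurable \<mu>" and q: "q \<in> borel_measurable \<mu>"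
    and dp: "distr \<mu> \<mu> (mul a) = density \<mu> p" and dq: "distr \<mu> \<mu> (mul b) = density \<mu> q"
  shows "distr \<mu> \<mu> (mul (a \<cdot> b)) = density \<mu> (\<lambda>x. p x * q (inv (mul a) x))"
proof -
  have ma: "mul a \<in> measurable \<mu> \<mu>" and mb: "mul b \<in> measurable \<mu> \<mu>"
    and mi: "inv (mul a) \<in> measurable \<mu> \<mu>"
    using continuous_measurable_radon[OF \<mu>] continuous_left_translation
      continuous_inv_left_translation by auto
  have qi: "(\<lambda>x. q (inv (mul a) x)) \<in> borel_measurable \<mu>"
    using measurable_compose[OF mi q] .
  have "mul (a \<cdot> b) = mul a \<circ> mul b"
    by (auto simp: assoc)
  then have "distr \<mu> \<mu> (mul (a \<cdot> b)) = distr (distr \<mu> \<mu> (mul b)) \<mu> (mul a)"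
    using distr_distr[OF ma mb] by simp
  also have "\<dots> = distr (density \<mu> (\<lambda>x. q (inv (mul a) (mul a x)))) \<mu> (mul a)"
    by (simp add: dq inv_left_translation left_div_mul)
  also have "\<dots> = density (distr \<mu> \<mu> (mul a)) (\<lambda>x. q (inv (mul a) x))"
    using density_distr[OF qi ma] by simp
  also have "\<dots> = density \<mu> (\<lambda>x. p x * q (inv (mul a) x))"
    using dp density_density_eq[OF p qi] by simp
  finally show ?thesis .
qed

text \<open>The right inverse, which associativity makes two-sided.\<close>

definition inverse_of :: "'a \<Rightarrow> 'a" where
  "inverse_of x = left_div mul x e"

lemma mul_inverse_of: "x \<cdot> inverse_of x = e"
  by (simp add: inverse_of_def mul_left_div)

lemma inverse_of_mul_cancel: "inverse_of x \<cdot> x = e"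
proof -
  have "x \<cdot> (inverse_of x \<cdot> x) = x \<cdot> e"
    by (simp add: assoc[symmetric] mul_inverse_of left_unit right_unit)
  then show ?thesis
    using left_solvable[of x "x \<cdot> e"] by blast
qed

lemma inverse_of_unique: "x \<cdot> y = e \<Longrightarrow> inverse_of x = y"
  using left_div_mul[of x y] by (simp add: inverse_of_def)

lemma inverse_of_inverse_of: "inverse_of (inverse_of x) = x"
  by (rule inverse_of_unique) (rule inverse_of_mul_cancel)

lemma inverse_of_mul: "inverse_of (x \<cdot> y) = inverse_of y \<cdot> inverse_of x"
proof (rule inverse_of_unique)
  have "(x \<cdot> y) \<cdot> (inverse_of y \<cdot> inverse_of x) = x \<cdot> ((y \<cdot> inverse_of y) \<cdot> inverse_of x)"
    by (simp add: assoc)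
  then show "(x \<cdot> y) \<cdot> (inverse_of y \<cdot> inverse_of x) = e"
    by (simp add: mul_inverse_of left_unit)
qed

lemma continuous_inverse_of: "continuous_on UNIV inverse_of"
  using continuous_on_compose2[OF continuous_left_div, of UNIV "\<lambda>x. (x, e)"]
  by (simp add: continuous_on_Pair inverse_of_def[abs_def])

lemma image_right_translation: "(\<lambda>x. x \<cdot> a) ` E = (\<lambda>x. x \<cdot> inverse_of a) -` E"
proof (intro set_eqI iffI)
  fix y assume "y \<in> (\<lambda>x. x \<cdot> a) ` E"
  then show "y \<in> (\<lambda>x. x \<cdot> inverse_of a) -` E"
    by (auto simp: assoc mul_inverse_of right_unit)
next
  fix y assume "y \<in> (\<lambda>x. x \<cdot> inverse_of a) -` E"
  moreover have "y = (y \<cdot> inverse_of a) \<cdot> a"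
    by (simp add: assoc inverse_of_mul_cancel right_unit)
  ultimately show "y \<in> (\<lambda>x. x \<cdot> a) ` E"
    by blast
qed

lemma left_haar_measure_distr_inverse:
  assumes "right_haar_measure mul \<mu>"
  shows "left_haar_measure mul (distr \<mu> \<mu> inverse_of)"
proof -
  have \<mu>: "radon_measure \<mu>" and nz: "emeasure \<mu> UNIV \<noteq> 0"
    and inv: "\<And>a. distr \<mu> \<mu> (\<lambda>x. x \<cdot> a) = \<mu>"
    using assms by (auto simp: right_haar_measure_def)
  note cm = continuous_measurable_radon[OF \<mu>]
  note mi = cm[OF continuous_inverse_of] and ml = cm[OF continuous_left_translation]
    and mr = cm[OF continuous_right_translation]
  let ?\<nu> = "distr \<mu> \<mu> inverse_of"
  have "emeasure ?\<nu> UNIV = emeasure \<mu> UNIV"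
    using mi radon_measure_space[OF \<mu>] sets.top[of \<mu>] by (simp add: emeasure_distr)
  moreover have "distr ?\<nu> ?\<nu> (mul a) = ?\<nu>" for a
  proof -
    have "distr ?\<nu> ?\<nu> (mul a) = distr ?\<nu> \<mu> (mul a)"
      by (rule distr_cong) simp_all
    also have "\<dots> = distr \<mu> \<mu> (mul a \<circ> inverse_of)"
      by (rule distr_distr[OF ml mi])
    also have "mul a \<circ> inverse_of = inverse_of \<circ> (\<lambda>x. x \<cdot> inverse_of a)"
      by (auto simp: inverse_of_mul inverse_of_inverse_of)
    also have "distr \<mu> \<mu> \<dots> = distr (distr \<mu> \<mu> (\<lambda>x. x \<cdot> inverse_of a)) \<mu> inverse_of"
      by (rule distr_distr[OF mi mr, symmetric])
    finally show ?thesis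
      by (simp add: inv)
  qed
  ultimately show ?thesis
    using nz radon_measure_distr_homeomorphism[OF \<mu> continuous_inverse_of continuous_inverse_of
        inverse_of_inverse_of inverse_of_inverse_of]
    by (simp add: left_haar_measure_def)
qed

text \<open>
  Inversion turns the scaling \<open>\<mu>(a\<inverse>E) = \<Delta>(a) \<mu>(E)\<close> under left translation into the scaling
  \<open>\<nu>(Ea) = \<Delta>(a) \<nu>(E)\<close> under right translation.
\<close>

lemma is_modular_function_of_right_haar:
  assumes haar: "right_haar_measure mul \<mu>" and pos: "\<And>a. 0 < \<Delta> a"
    and scale: "\<And>a. distr \<mu> \<mu> (mul a) = density \<mu> (\<lambda>_. ennreal (\<Delta> a))"
  shows "is_modular_function mul \<Delta>"
proof -
  have \<mu>: "radon_measure \<mu>"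
    using haar by (simp add: right_haar_measure_def)
  note cm = continuous_measurable_radon[OF \<mu>]
  note mi = cm[OF continuous_inverse_of] and ml = cm[OF continuous_left_translation]
    and mr = cm[OF continuous_right_translation]
  note [simp] = radon_measure_space[OF \<mu>]
  let ?\<nu> = "distr \<mu> \<mu> inverse_of"
  have "emeasure ?\<nu> ((\<lambda>x. x \<cdot> a) ` E) = ennreal (\<Delta> a) * emeasure ?\<nu> E" if "E \<in> sets borel" for a E
  proof -
    have E: "E \<in> sets \<mu>"
      using that radon_measure_sets[OF \<mu>] by simp
    have Ei: "inverse_of -` E \<in> sets \<mu>"
      using measurable_sets[OF mi E] by simp
    have Ea: "(\<lambda>x. x \<cdot> a) ` E \<in> sets \<mu>"
      using measurable_sets[OF mr E] by (simp add: image_right_translation)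
    have "inverse_of -` ((\<lambda>x. x \<cdot> a) ` E) = mul a -` (inverse_of -` E)"
      by (auto simp: image_right_translation inverse_of_mul)
    then have "emeasure ?\<nu> ((\<lambda>x. x \<cdot> a) ` E) = emeasure (distr \<mu> \<mu> (mul a)) (inverse_of -` E)"
      using mi ml Ea Ei by (simp add: emeasure_distr)
    also have "\<dots> = ennreal (\<Delta> a) * emeasure \<mu> (inverse_of -` E)"
      using Ei by (simp add: scale emeasure_density nn_integral_cmult_indicator)
    also have "\<dots> = ennreal (\<Delta> a) * emeasure ?\<nu> E"
      using mi E by (simp add: emeasure_distr)
    finally show ?thesis .
  qed
  then show ?thesis
    using left_haar_measure_distr_inverse[OF haar] pos unfolding is_modular_function_def by blast
qed

end

section \<open>The cocycle identity and the modular function\<close>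

theorem corollary4p6:
  fixes mul :: "'a::t2_space \<Rightarrow> 'a \<Rightarrow> 'a" (infixl "\<cdot>" 70)
    and e :: 'a
    and \<mu> :: "'a measure"
    and l :: "'a \<Rightarrow> 'a \<Rightarrow> real"
  assumes "topological_loop mul e"
    and "locally compact (UNIV :: 'a set)"
    and "radon_measure \<mu>"
    and "left_quasi_invariant mul \<mu>"
    and "left_modular_cocycle mul \<mu> l"
    and assoc: "\<forall>a b c. (a \<cdot> b) \<cdot> c = a \<cdot> (b \<cdot> c)"
  shows "(\<forall>a b. assoc_deviation mul a b = id) \<and>
    (\<forall>a b. AE x in \<mu>. assoc_jacobian mul \<mu> a b x = 1) \<and>
    (\<forall>a b. AE x in \<mu>. l a x * l b (inv (mul a) x) = l (a \<cdot> b) x) \<and>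
    (\<forall>\<Delta>\<^sub>L :: 'a \<Rightarrow> real.
       emeasure \<mu> UNIV \<noteq> 0 \<and> (\<forall>a. AE x in \<mu>. l a x = \<Delta>\<^sub>L a) \<longrightarrow>
         (\<forall>a b. \<Delta>\<^sub>L (a \<cdot> b) = \<Delta>\<^sub>L a * \<Delta>\<^sub>L b) \<and>
         (right_haar_measure mul \<mu> \<longrightarrow> is_modular_function mul \<Delta>\<^sub>L))"
proof -
  interpret associative_topological_loop mul e
    using assms(1) assoc
    by (simp add: associative_topological_loop_def associative_topological_loop_axioms_def)
  note \<mu> = \<open>radon_measure \<mu>\<close> and l = \<open>left_modular_cocycle mul \<mu> l\<close>
  have l_pos: "0 < l a x" for a x
    using l by (simp add: left_modular_cocycle_def)
  have l_meas: "(\<lambda>x. ennreal (l a x)) \<in> borel_measurable \<mu>" for a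
    using l borel_measurable_radon[OF \<mu>, of "l a"] by (simp add: left_modular_cocycle_def)
  note dens = left_modular_cocycle_density[OF \<mu> l continuous_left_translation]

  have jacobian: "AE x in \<mu>. assoc_jacobian mul \<mu> a b x = 1" for a b
  proof -
    have "distr \<mu> \<mu> (assoc_deviation mul a b) = density \<mu> (\<lambda>_. 1)"
      by (simp add: assoc_deviation_id id_def density_1)
    then have "density \<mu> (assoc_jacobian mul \<mu> a b) = density \<mu> (\<lambda>_. 1)"
      unfolding assoc_jacobian_def
      by (metis RN_derivI borel_measurable_const)
    then show ?thesis
      by (intro radon_density_unique[OF \<mu>]) (simp_all add: assoc_jacobian_def)
  qed

  have cocycle: "AE x in \<mu>. l a x * l b (inv (mul a) x) = l (a \<cdot> b) x" for a b
  proof -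
    let ?p = "\<lambda>x. ennreal (l a x) * ennreal (l b (inv (mul a) x))"
    have "(\<lambda>x. ennreal (l b (inv (mul a) x))) \<in> borel_measurable \<mu>"
      using measurable_compose[OF continuous_measurable_radon[OF \<mu> continuous_inv_left_translation]
          l_meas] .
    then have "?p \<in> borel_measurable \<mu>"
      using l_meas[of a] by measurable
    moreover have "density \<mu> ?p = density \<mu> (\<lambda>x. ennreal (l (a \<cdot> b) x))"
      using density_translate_mul[OF \<mu> l_meas l_meas dens dens, of a b] dens[of "a \<cdot> b"] by simp
    ultimately have "AE x in \<mu>. ?p x = ennreal (l (a \<cdot> b) x)"
      by (intro radon_density_unique[OF \<mu>] l_meas)
    then show ?thesis
      by eventually_elim (simp add: ennreal_mult[symmetric] l_pos less_imp_le)
  qed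

  have constant_case: "(\<forall>a b. \<Delta> (a \<cdot> b) = \<Delta> a * \<Delta> b) \<and>
      (right_haar_measure mul \<mu> \<longrightarrow> is_modular_function mul \<Delta>)"
    if nz: "emeasure \<mu> UNIV \<noteq> 0" and \<Delta>: "\<And>a. AE x in \<mu>. l a x = \<Delta> a" for \<Delta> :: "'a \<Rightarrow> real"
  proof -
    \<comment> \<open>As \<open>\<mu>\<close> is nonzero, properties that hold almost everywhere hold at some point.\<close>
    have AE_constD: P if "AE x in \<mu>. P" for P
    proof (rule ccontr)
      assume "\<not> P"
      with that have "AE x in \<mu>. x \<notin> space \<mu>"
        by simp
      then have "space \<mu> \<in> null_sets \<mu>"
        by (simp add: AE_iff_null_sets)
      then show False
        using nz radon_measure_space[OF \<mu>] by auto
    qed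
    have pos: "0 < \<Delta> a" for a
      by (rule AE_constD, use \<Delta>[of a] in eventually_elim) (use l_pos in metis)
    have scale: "distr \<mu> \<mu> (mul a) = density \<mu> (\<lambda>_. ennreal (\<Delta> a))" for a
      unfolding dens using \<Delta>[of a] l_meas by (intro density_cong) auto
    have "\<Delta> (a \<cdot> b) = \<Delta> a * \<Delta> b" for a b
    proof -
      have "density \<mu> (\<lambda>_. ennreal (\<Delta> a) * ennreal (\<Delta> b)) = density \<mu> (\<lambda>_. ennreal (\<Delta> (a \<cdot> b)))"
        using density_translate_mul[OF \<mu> _ _ scale scale, of a b] scale[of "a \<cdot> b"] by simp
      then have "AE x in \<mu>. ennreal (\<Delta> a) * ennreal (\<Delta> b) = ennreal (\<Delta> (a \<cdot> b))"
        by (intro radon_density_unique[OF \<mu>]) auto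
      then have "ennreal (\<Delta> a) * ennreal (\<Delta> b) = ennreal (\<Delta> (a \<cdot> b))"
        by (rule AE_constD)
      then show ?thesis
        using pos[of a] pos[of b] pos[of "a \<cdot> b"] by (simp add: ennreal_mult[symmetric])
    qed
    with is_modular_function_of_right_haar[OF _ pos scale] show ?thesis
      by blast
  qed

  show ?thesis
    using assoc_deviation_id jacobian cocycle constant_case by blast
qed

end
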